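(* Let $\mathbf{k}$ and $\alpha$ be positive integers and let $G$ be a bi-block graph on $\mathbf{k}$ vertices with independence number $\alpha(G)=\alpha$. Then $\rho(G) \leq \rho(K_{\alpha, \mathbf{k}-\alpha})$, and equality holds if and only if $G = K_{\alpha, \mathbf{k}-\alpha}$.
   Context: All graphs are finite, simple and connected. A block of a graph is a maximal connected subgraph without a cut-vertex. A connected graph is a bi-block graph if each of its blocks is a complete bipartite graph. (By convention of the paper, the star $K_{1,n}$ is regarded as a complete bipartite graph.) $K_{a,b}$ denotes the complete bipartite graph with parts of sizes $a$ and $b$. $\alpha(G)$ is the independence number of $G$ (the maximum size of a set of pairwise non-adjacent vertices). $\rho(G)$ denotes the spectral radius (largest eigenvalue) of the adjacency matrix of $G$. *)

theory Defs
  imports "Graph_Theory.Graph_Theory" "Jordan_Normal_Form.Spectral_Radius"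
begin

text \<open>
  A finite simple graph is a \<^term>\<open>graph\<close> in the sense of the library: a finite, loop-free
  symmetric digraph without parallel arcs, each edge being a pair of opposite arcs.
  Adjacency of u and v is \<open>(u, v) \<in> arcs_ends G\<close>.
\<close>

definition cut_vertex :: "('a, 'b) pre_digraph \<Rightarrow> 'a \<Rightarrow> bool" where
  "cut_vertex G v \<longleftrightarrow> v \<in> verts G \<and>
     (\<exists>u \<in> verts G - {v}. \<exists>w \<in> verts G - {v}.
        u \<rightarrow>\<^sup>*\<^bsub>G\<^esub> w \<and> \<not> u \<rightarrow>\<^sup>*\<^bsub>pre_digraph.del_vert G v\<^esub> w)"

text \<open>
  Subgraphs of a digraph need not be symmetric, hence the explicit \<^term>\<open>graph\<close> condition.
\<close>

definition block :: "('a, 'b) pre_digraph \<Rightarrow> ('a, 'b) pre_digraph \<Rightarrow> bool" where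
  "block G B \<longleftrightarrow>
     pre_digraph.max_subgraph G
       (\<lambda>H. graph H \<and> Digraph_Component.connected H \<and> \<not> (\<exists>v. cut_vertex H v)) B"

text \<open>
  The library predicate \<open>K\<^bsub>m,n\<^esub>\<close> allows an empty part. As blocks are connected, this only
  matters for the single vertex \<open>K\<^bsub>1,0\<^esub>\<close>, so that the one-vertex graph is a bi-block graph.
\<close>

definition bi_block_graph :: "('a, 'b) pre_digraph \<Rightarrow> bool" where
  "bi_block_graph G \<longleftrightarrow>
     graph G \<and> Digraph_Component.connected G \<and> (\<forall>B. block G B \<longrightarrow> (\<exists>m n. K\<^bsub>m,n\<^esub> B))"

definition independent_set :: "('a, 'b) pre_digraph \<Rightarrow> 'a set \<Rightarrow> bool" where
  "independent_set G S \<longleftrightarrow> S \<subseteq> verts G \<and> (\<forall>u \<in> S. \<forall>v \<in> S. (u, v) \<notin> arcs_ends G)"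

definition independence_number :: "('a, 'b) pre_digraph \<Rightarrow> nat" where
  "independence_number G = Max {card S |S. independent_set G S}"

definition adjacency_mat :: "('a, 'b) pre_digraph \<Rightarrow> 'a list \<Rightarrow> complex mat" where
  "adjacency_mat G vs =
     mat (length vs) (length vs) (\<lambda>(i, j). if (vs ! i, vs ! j) \<in> arcs_ends G then 1 else 0)"

text \<open>
  The rows and columns are indexed by an arbitrary enumeration of the vertices; by
  \<open>graph_spectral_radius_eq\<close> below the choice is irrelevant.
\<close>

definition graph_spectral_radius :: "('a, 'b) pre_digraph \<Rightarrow> real" where
  "graph_spectral_radius G =
     spectral_radius (adjacency_mat G (SOME vs. distinct vs \<and> set vs = verts G))"

definition complete_bipartite :: "nat \<Rightarrow> nat \<Rightarrow> nat pair_pre_digraph" where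
  "complete_bipartite m n =
     \<lparr> pverts = {..<m + n},
       parcs = {..<m} \<times> {m..<m + n} \<union> {m..<m + n} \<times> {..<m} \<rparr>"

lemma complete_bipartite_digraph_complete_bipartite:
  "K\<^bsub>m,n\<^esub> (with_proj (complete_bipartite m n))"
proof -
  have "{..<m + n} = {..<m} \<union> {m..<m + n}" "{..<m} \<inter> {m..<m + n} = {}" by auto
  moreover have "card {..<m} = m" "card {m..<m + n} = n" by simp_all
  ultimately show ?thesis
    unfolding complete_bipartite_digraph_pair_def complete_bipartite_def
      pair_pre_digraph.simps
    by blast
qed

lemma eigenvalue_adjacency_mat_iff:
  assumes "distinct vs"
  shows "eigenvalue (adjacency_mat G vs) a \<longleftrightarrow>
    (\<exists>f. (\<exists>v \<in> set vs. f v \<noteq> 0) \<and>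
         (\<forall>u \<in> set vs. (\<Sum>v\<in>set vs. if (u, v) \<in> arcs_ends G then f v else 0) = a * f u))"
    (is "?L \<longleftrightarrow> ?R")
proof -
  let ?n = "length vs"
  have bij: "bij_betw ((!) vs) {..<?n} (set vs)"
    using assms by (intro bij_betw_nth) auto
  have sum: "(\<Sum>v\<in>set vs. g v) = (\<Sum>j = 0..<?n. g (vs ! j))" for g :: "'a \<Rightarrow> complex"
    using sum.reindex_bij_betw[OF bij, of g] by (simp add: atLeast0LessThan)
  have mult: "(adjacency_mat G vs *\<^sub>v x) $ i =
      (\<Sum>j = 0..<?n. if (vs ! i, vs ! j) \<in> arcs_ends G then x $ j else 0)"
    if "x \<in> carrier_vec ?n" "i < ?n" for x i
    using that by (auto simp: adjacency_mat_def scalar_prod_def intro!: sum.cong)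
  have dim: "dim_row (adjacency_mat G vs) = ?n"
    by (simp add: adjacency_mat_def)
  show ?thesis
  proof
    assume ?L
    then obtain x where x: "x \<in> carrier_vec ?n" "x \<noteq> 0\<^sub>v ?n"
      "adjacency_mat G vs *\<^sub>v x = a \<cdot>\<^sub>v x"
      by (auto simp: eigenvalue_def eigenvector_def dim)
    define f where "f v = x $ (the_inv_into {..<?n} ((!) vs) v)" for v
    have f: "f (vs ! i) = x $ i" if "i < ?n" for i
      using bij that by (simp add: f_def the_inv_into_f_f bij_betw_def)
    from x(1,2) obtain i where i: "i < ?n" "x $ i \<noteq> 0"
      by (metis carrier_vecD eq_vecI index_zero_vec)
    show ?R
    proof (intro exI[of _ f] conjI ballI)
      show "\<exists>v \<in> set vs. f v \<noteq> 0"
        using i f by (intro bexI[of _ "vs ! i"]) auto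
      fix u assume "u \<in> set vs"
      then obtain i where i: "i < ?n" "u = vs ! i" by (metis in_set_conv_nth)
      have "(\<Sum>v\<in>set vs. if (u, v) \<in> arcs_ends G then f v else 0) =
          (adjacency_mat G vs *\<^sub>v x) $ i"
        unfolding sum mult[OF x(1) i(1)] by (rule sum.cong) (auto simp: f i)
      also have "\<dots> = a * f u" using i x f by simp
      finally show "(\<Sum>v\<in>set vs. if (u, v) \<in> arcs_ends G then f v else 0) = a * f u" .
    qed
  next
    assume ?R
    then obtain f v where f: "v \<in> set vs" "f v \<noteq> 0"
      "\<And>u. u \<in> set vs \<Longrightarrow> (\<Sum>v\<in>set vs. if (u, v) \<in> arcs_ends G then f v else 0) = a * f u"
      by blast
    define x where "x = vec ?n (\<lambda>i. f (vs ! i))"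
    have x: "x \<in> carrier_vec ?n" by (simp add: x_def)
    obtain i where i: "i < ?n" "v = vs ! i" using f(1) by (metis in_set_conv_nth)
    have "x $ i \<noteq> 0\<^sub>v ?n $ i" using i f by (simp add: x_def)
    then have "x \<noteq> 0\<^sub>v ?n" by metis
    moreover have "adjacency_mat G vs *\<^sub>v x = a \<cdot>\<^sub>v x"
    proof (rule eq_vecI)
      fix i assume "i < dim_vec (a \<cdot>\<^sub>v x)"
      then have i: "i < ?n" by (simp add: x_def)
      have "(adjacency_mat G vs *\<^sub>v x) $ i =
          (\<Sum>v\<in>set vs. if (vs ! i, v) \<in> arcs_ends G then f v else 0)"
        unfolding sum mult[OF x i] by (rule sum.cong) (auto simp: x_def)
      also have "\<dots> = (a \<cdot>\<^sub>v x) $ i" using i f(3)[of "vs ! i"] by (simp add: x_def)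
      finally show "(adjacency_mat G vs *\<^sub>v x) $ i = (a \<cdot>\<^sub>v x) $ i" .
    qed (simp add: adjacency_mat_def x_def)
    ultimately show ?L using x by (auto simp: eigenvalue_def eigenvector_def dim)
  qed
qed

lemma graph_spectral_radius_eq:
  assumes "distinct vs" "set vs = verts G"
  shows "graph_spectral_radius G = spectral_radius (adjacency_mat G vs)"
proof -
  let ?ws = "SOME vs. distinct vs \<and> set vs = verts G"
  have ws: "distinct ?ws \<and> set ?ws = verts G"
    by (rule someI[of _ vs]) (use assms in simp)
  have "spectrum (adjacency_mat G ?ws) = spectrum (adjacency_mat G vs)"
    unfolding spectrum_def using ws assms by (auto simp: eigenvalue_adjacency_mat_iff)
  then show ?thesis by (simp add: graph_spectral_radius_def spectral_radius_def)
qed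

end

theory Submission
  imports Defs
begin

text \<open>
  A triangle lies in a block, and complete bipartite graphs are triangle-free; hence so is
  G. The squared spectral radius is at most the number of walks of length two from some
  vertex u. As N(u) is independent, each edge contributes at most one of these walks, so
  their number is at most the number of edges. The complement S of a maximum independent set
  meets every edge, and the degree of a vertex is at most \<open>\<alpha>\<close> because its neighbourhood is
  independent; hence there are at most \<open>\<alpha> (k - \<alpha>)\<close> edges. If equality holds, no edge is met
  twice by S, and every vertex of S has degree \<open>\<alpha>\<close>, so it is adjacent to all vertices
  outside S.
\<close>

section \<open>Blocks and triangles\<close>

text \<open>Applied below to a triangle. Distinct vertices are joined by an arc, and this survives
  the deletion of a vertex, so no deletion can separate anything.\<close>

lemma complete_graph_connected_no_cut_vertex:
  assumes "graph H" "verts H \<noteq> {}"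
    and adj: "\<And>u v. u \<in> verts H \<Longrightarrow> v \<in> verts H \<Longrightarrow> u \<noteq> v \<Longrightarrow> u \<rightarrow>\<^bsub>H\<^esub> v"
  shows "Digraph_Component.connected H" "\<not> cut_vertex H v"
proof -
  interpret graph H by fact
  have "u \<rightarrow>\<^sup>*\<^bsub>H\<^esub> w" if "u \<in> verts H" "w \<in> verts H" for u w
    using that adj by (cases "u = w") auto
  then show "Digraph_Component.connected H"
    using assms(2) unfolding connected_def strongly_connected_def
    by (auto intro: reachable_mk_symmetricI)
  interpret D: wf_digraph "del_vert v" by (rule wf_digraph_del_vert)
  have "u \<rightarrow>\<^sup>*\<^bsub>del_vert v\<^esub> w" if "u \<in> verts H - {v}" "w \<in> verts H - {v}" for u w
  proof (cases "u = w")
    case True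
    then show ?thesis using that by (auto simp: verts_del_vert)
  next
    case False
    then have "u \<rightarrow>\<^bsub>H\<^esub> w" using that adj by auto
    then have "u \<rightarrow>\<^bsub>del_vert v\<^esub> w"
      using that by (auto simp: arcs_ends_conv del_vert_simps)
    then show ?thesis by auto
  qed
  then show "\<not> cut_vertex H v" unfolding cut_vertex_def by blast
qed

text \<open>By finiteness, some subgraph above \<open>H\<close> with \<open>P\<close> maximises the
  number of vertices plus arcs, and a proper extension would have a larger count. This supplies a
  block around a given subgraph.\<close>

lemma (in fin_digraph) max_subgraph_exists:
  assumes "subgraph H G" "P H"
  obtains B where "max_subgraph P B" "subgraph H B"
proof -
  let ?Q = "\<lambda>B. subgraph H B \<and> subgraph B G \<and> P B"
  let ?m = "\<lambda>B. card (verts B) + card (arcs B)"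
  have bound: "?m B \<le> ?m G" if "subgraph B G" for B
    using that by (intro add_mono card_mono) (auto simp: subgraph_def)
  have "?Q H" using assms by (auto simp: subgraph_def compatible_def)
  moreover have "\<forall>B. ?Q B \<longrightarrow> ?m B < Suc (?m G)" using bound by (simp add: less_Suc_eq_le)
  ultimately have "\<exists>B. ?Q B \<and> (\<forall>C. ?Q C \<longrightarrow> ?m C \<le> ?m B)"
    by (rule ex_has_greatest_nat)
  then obtain B where B: "?Q B" and greatest: "\<And>C. ?Q C \<Longrightarrow> ?m C \<le> ?m B"
    by blast
  have "max_subgraph P B"
  proof (rule max_subgraphI)
    fix C assume C: "B \<noteq> C" "subgraph B C" "subgraph C G"
    have fin: "finite (verts C)" "finite (arcs C)"
      using C(3) by (auto simp: subgraph_def intro: finite_subset)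
    have sub: "verts B \<subseteq> verts C" "arcs B \<subseteq> arcs C" "tail B = tail C" "head B = head C"
      using C(2) by (auto simp: subgraph_def compatible_def)
    \<comment> \<open>With equal \<open>tail\<close> and \<open>head\<close> maps, distinct graphs
      must differ in their vertices or their arcs.\<close>
    then have "verts B \<subset> verts C \<or> arcs B \<subset> arcs C"
      using C(1) by (auto intro: pre_digraph.equality)
    then have "?m B < ?m C"
      using sub fin by (metis add_le_less_mono add_less_le_mono card_mono psubset_card_mono)
    moreover have "subgraph H C" using B C by (blast intro: subgraph_trans)
    ultimately show "\<not> P C" using greatest[of C] C(3) by auto
  qed (use B in auto)
  then show ?thesis using that B by blast
qed

lemma bi_block_graph_triangle_free:
  assumes bb: "bi_block_graph G"
    and xyz: "x \<rightarrow>\<^bsub>G\<^esub> y" "y \<rightarrow>\<^bsub>G\<^esub> z" "x \<rightarrow>\<^bsub>G\<^esub> z"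
  shows False
proof -
  interpret graph G using bb by (simp add: bi_block_graph_def)
  \<comment> \<open>The induced subgraph inherits symmetry from \<open>G\<close>, so it is a
    \<open>graph\<close>, as the definition of a block demands.\<close>
  define H where "H = G \<restriction> {x, y, z}"
  have ind: "induced_subgraph H G"
    unfolding H_def using xyz by (intro induced_induce) (auto dest: adj_in_verts)
  then have sub: "subgraph H G" by (rule induced_imp_subgraph)
  have H: "verts H = {x, y, z}" by (simp add: H_def)
  have adj: "u \<rightarrow>\<^bsub>H\<^esub> v \<longleftrightarrow> u \<in> {x, y, z} \<and> v \<in> {x, y, z} \<and> u \<rightarrow>\<^bsub>G\<^esub> v" for u v
    by (auto simp: H_def arcs_ends_conv)
  have sym: "v \<rightarrow>\<^bsub>G\<^esub> u" if "u \<rightarrow>\<^bsub>G\<^esub> v" for u v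
    using that arcs_ends_symmetric[OF sym_arcs] by blast
  have "graph H"
    using digraphI_induced[OF ind] induced_graph_imp_symmetric[OF sym_arcs ind]
    by (rule digraph.graphI)
  moreover have "u \<rightarrow>\<^bsub>H\<^esub> v" if "u \<in> verts H" "v \<in> verts H" "u \<noteq> v" for u v
    using that xyz by (auto simp: H adj intro: sym)
  ultimately have "Digraph_Component.connected H" "\<not> (\<exists>v. cut_vertex H v)"
    using complete_graph_connected_no_cut_vertex[of H] by (auto simp: H)
  with \<open>graph H\<close> sub obtain B where "block G B" and HB: "subgraph H B"
    unfolding block_def
    by (rule_tac max_subgraph_exists[of H "\<lambda>H. graph H \<and> Digraph_Component.connected H
      \<and> \<not> (\<exists>v. cut_vertex H v)"]) auto
  then obtain U V where UV: "arcs_ends B = U \<times> V \<union> V \<times> U" "U \<inter> V = {}"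
    using bb unfolding bi_block_graph_def complete_bipartite_digraph_def by blast
  have "u \<rightarrow>\<^bsub>B\<^esub> v" if "u \<rightarrow>\<^bsub>H\<^esub> v" for u v
    using that HB by (auto simp: subgraph_def compatible_def arcs_ends_conv)
  then have "x \<rightarrow>\<^bsub>B\<^esub> y" "y \<rightarrow>\<^bsub>B\<^esub> z" "x \<rightarrow>\<^bsub>B\<^esub> z" using xyz by (auto simp: adj)
  then show False unfolding UV(1) using UV(2) by blast
qed

section \<open>The spectral radius of a graph\<close>

text \<open>Trades the adjacency matrix for a function on the vertices. The spectral radius is a
  maximal modulus over complex eigenvalues, hence the form \<open>cmod a\<close>; a nonempty vertex
  set makes the spectrum nonempty.\<close>

lemma (in fin_digraph) graph_spectral_radius_eigenfunction:
  assumes "verts G \<noteq> {}"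
  obtains a f where "graph_spectral_radius G = cmod a" "\<exists>v\<in>verts G. f v \<noteq> 0"
    "\<And>u. u \<in> verts G \<Longrightarrow> (\<Sum>v | u \<rightarrow>\<^bsub>G\<^esub> v. f v) = a * f u"
proof -
  obtain vs where vs: "distinct vs" "set vs = verts G"
    using finite_distinct_list[OF finite_verts] by blast
  let ?A = "adjacency_mat G vs"
  have "?A \<in> carrier_mat (length vs) (length vs)" "length vs > 0"
    using vs assms by (auto simp: adjacency_mat_def)
  then have "spectral_radius ?A \<in> norm ` spectrum ?A" by (rule spectral_radius_mem_max)
  then obtain a where a: "graph_spectral_radius G = cmod a" "eigenvalue ?A a"
    by (auto simp: graph_spectral_radius_eq[OF vs] spectrum_def)
  obtain f where f: "\<exists>v\<in>verts G. f v \<noteq> 0"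
    "\<And>u. u \<in> verts G \<Longrightarrow> (\<Sum>v\<in>verts G. if u \<rightarrow>\<^bsub>G\<^esub> v then f v else 0) = a * f u"
    using a(2) unfolding eigenvalue_adjacency_mat_iff[OF vs(1)] vs(2) by blast
  have "(\<Sum>v\<in>verts G. if u \<rightarrow>\<^bsub>G\<^esub> v then f v else 0) = (\<Sum>v | u \<rightarrow>\<^bsub>G\<^esub> v. f v)" for u
    by (simp add: sum.inter_filter[symmetric], rule sum.cong) (auto dest: adj_in_verts)
  then show ?thesis using that[OF a(1) f(1)] f(2) by simp
qed

text \<open>The tool for lower bounds: an explicit eigenfunction puts \<open>a\<close> into the
  spectrum.\<close>

lemma (in fin_digraph) eigenfunction_le_graph_spectral_radius:
  assumes "\<exists>v\<in>verts G. f v \<noteq> 0"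
    "\<And>u. u \<in> verts G \<Longrightarrow> (\<Sum>v | u \<rightarrow>\<^bsub>G\<^esub> v. f v) = a * f u"
  shows "cmod a \<le> graph_spectral_radius G"
proof -
  obtain vs where vs: "distinct vs" "set vs = verts G"
    using finite_distinct_list[OF finite_verts] by blast
  let ?A = "adjacency_mat G vs"
  have "(\<Sum>v\<in>verts G. if u \<rightarrow>\<^bsub>G\<^esub> v then f v else 0) = (\<Sum>v | u \<rightarrow>\<^bsub>G\<^esub> v. f v)" for u
    by (simp add: sum.inter_filter[symmetric], rule sum.cong) (auto dest: adj_in_verts)
  then have "eigenvalue ?A a"
    unfolding eigenvalue_adjacency_mat_iff[OF vs(1)] vs(2) using assms by metis
  moreover have "?A \<in> carrier_mat (length vs) (length vs)" "length vs > 0"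
    using vs assms(1) by (auto simp: adjacency_mat_def)
  ultimately show ?thesis
    unfolding graph_spectral_radius_eq[OF vs]
    by (intro spectral_radius_mem_max(2)) (auto simp: spectrum_def)
qed

lemma (in fin_digraph) graph_spectral_radius_nonneg:
  "verts G \<noteq> {} \<Longrightarrow> 0 \<le> graph_spectral_radius G"
  using graph_spectral_radius_eigenfunction by (metis norm_ge_zero)

lemma (in fin_digraph) finite_successors: "finite {v. u \<rightarrow>\<^bsub>G\<^esub> v}"
  by (rule finite_subset[OF _ finite_verts]) (auto dest: adj_in_verts)

text \<open>Apply the eigenvalue equation twice at a vertex \<open>u\<close> where the modulus of
  \<open>f\<close> is maximal. The triangle inequality then gives one copy of
  \<open>cmod (f u)\<close> per walk \<open>u, v, w\<close>, stored as the pair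
  \<open>(v, w)\<close>.\<close>

lemma (in fin_digraph) graph_spectral_radius_power2_le_walks:
  assumes "verts G \<noteq> {}"
  obtains u where "u \<in> verts G"
    "(graph_spectral_radius G)\<^sup>2 \<le> card (SIGMA v:{v. u \<rightarrow>\<^bsub>G\<^esub> v}. {w. v \<rightarrow>\<^bsub>G\<^esub> w})"
proof -
  obtain a f where a: "graph_spectral_radius G = cmod a" and f0: "\<exists>v\<in>verts G. f v \<noteq> 0"
    and f: "\<And>u. u \<in> verts G \<Longrightarrow> (\<Sum>v | u \<rightarrow>\<^bsub>G\<^esub> v. f v) = a * f u"
    using graph_spectral_radius_eigenfunction[OF assms] by blast
  have "Max ((\<lambda>v. cmod (f v)) ` verts G) \<in> (\<lambda>v. cmod (f v)) ` verts G"
    using assms by (intro Max_in) auto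
  then obtain u where u: "u \<in> verts G" and "Max ((\<lambda>v. cmod (f v)) ` verts G) = cmod (f u)"
    by blast
  then have max: "cmod (f v) \<le> cmod (f u)" if "v \<in> verts G" for v
    using that by (metis Max_ge finite_imageI finite_verts imageI)
  \<comment> \<open>Since \<open>f\<close> is not identically zero, its maximal modulus is positive
    and can be cancelled at the end.\<close>
  have pos: "cmod (f u) > 0" using f0 max by (meson less_le_trans zero_less_norm_iff)
  have "a\<^sup>2 * f u = a * (\<Sum>v | u \<rightarrow>\<^bsub>G\<^esub> v. f v)" using f[OF u] by (simp add: power2_eq_square)
  also have "\<dots> = (\<Sum>v | u \<rightarrow>\<^bsub>G\<^esub> v. \<Sum>w | v \<rightarrow>\<^bsub>G\<^esub> w. f w)"
    unfolding sum_distrib_left by (intro sum.cong) (auto simp: f adj_in_verts)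
  finally have "(cmod a)\<^sup>2 * cmod (f u) = cmod (\<Sum>v | u \<rightarrow>\<^bsub>G\<^esub> v. \<Sum>w | v \<rightarrow>\<^bsub>G\<^esub> w. f w)"
    by (metis norm_mult norm_power)
  also have "\<dots> \<le> (\<Sum>v | u \<rightarrow>\<^bsub>G\<^esub> v. \<Sum>w | v \<rightarrow>\<^bsub>G\<^esub> w. cmod (f u))"
    by (intro order_trans[OF norm_sum] sum_mono) (auto intro: max adj_in_verts)
  also have "\<dots> = card (SIGMA v:{v. u \<rightarrow>\<^bsub>G\<^esub> v}. {w. v \<rightarrow>\<^bsub>G\<^esub> w}) * cmod (f u)"
    by (simp add: card_SigmaI finite_successors sum_distrib_right)
  finally show ?thesis using that[OF u] pos by (simp add: a)
qed

text \<open>Enumerating the vertices of \<open>H\<close> by the image of an enumeration for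
  \<open>G\<close> yields literally the same matrix.\<close>

lemma graph_spectral_radius_iso:
  assumes "fin_digraph G" "digraph_iso G H"
  shows "graph_spectral_radius H = graph_spectral_radius G"
proof -
  interpret fin_digraph G by fact
  obtain h where h: "digraph_isomorphism h" and H: "H = app_iso h G"
    using assms(2) by (auto simp: digraph_iso_def)
  have inj: "inj_on (iso_verts h) (verts G)" using h by (rule digraph_isomorphism_inj_on_verts)
  obtain vs where vs: "distinct vs" "set vs = verts G"
    using finite_distinct_list[OF finite_verts] by blast
  have "(iso_verts h u, iso_verts h v) \<in> arcs_ends H \<longleftrightarrow> u \<rightarrow>\<^bsub>G\<^esub> v"
    if "u \<in> verts G" "v \<in> verts G" for u v
    using that inj unfolding H arcs_ends_app_iso_eq[OF h]
    by (auto dest: inj_onD adj_in_verts)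
  then have "adjacency_mat H (map (iso_verts h) vs) = adjacency_mat G vs"
    by (auto simp: adjacency_mat_def vs(2)[symmetric])
  moreover have "distinct (map (iso_verts h) vs)" "set (map (iso_verts h) vs) = verts H"
    using vs inj by (auto simp: distinct_map H)
  ultimately show ?thesis using graph_spectral_radius_eq vs by metis
qed

text \<open>An eigenfunction constant on each part exhibits \<open>sqrt (m * n)\<close> as an
  eigenvalue. This bound is the pivot of the final comparison.\<close>

lemma graph_spectral_radius_complete_bipartite_ge:
  assumes "m > 0"
  shows "sqrt (real m * real n)
    \<le> graph_spectral_radius (with_proj (complete_bipartite m n))"
proof -
  let ?K = "with_proj (complete_bipartite m n)"
  interpret K: graph ?K
    using complete_bipartite_digraph_complete_bipartite
    by (auto simp: complete_bipartite_digraph_def)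
  have V: "verts ?K = {..<m + n}" by (simp add: complete_bipartite_def)
  have nbr: "{v. u \<rightarrow>\<^bsub>?K\<^esub> v} = (if u < m then {m..<m + n} else {..<m})" if "u < m + n" for u
    using that by (auto simp: complete_bipartite_def)
  show ?thesis
  \<comment> \<open>For \<open>n = 0\<close> the eigenfunction chosen below vanishes identically, so
    nonnegativity of the spectral radius is used instead.\<close>
  proof (cases "n = 0")
    case True
    then show ?thesis using K.graph_spectral_radius_nonneg V assms by auto
  next
    case False
    \<comment> \<open>Each part is weighted by the square root of the size of the other part, so
      that \<open>n * sqrt m = sqrt (m * n) * sqrt n\<close>, and symmetrically.\<close>
    let ?f = "\<lambda>v. complex_of_real (if v < m then sqrt n else sqrt m)"
    have "(\<Sum>v | u \<rightarrow>\<^bsub>?K\<^esub> v. ?f v) = complex_of_real (sqrt (real m * real n)) * ?f u"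
      if "u \<in> verts ?K" for u
    proof (cases "u < m")
      case True
      then have "(\<Sum>v | u \<rightarrow>\<^bsub>?K\<^esub> v. ?f v) = complex_of_real (real n * sqrt m)"
        using nbr[of u] by simp
      also have "real n * sqrt m = sqrt (real m * real n) * sqrt n"
        by (simp add: real_sqrt_mult)
      finally show ?thesis using True by simp
    next
      case False
      then have "(\<Sum>v | u \<rightarrow>\<^bsub>?K\<^esub> v. ?f v) = complex_of_real (real m * sqrt n)"
        using nbr[of u] that V by simp
      also have "real m * sqrt n = sqrt (real m * real n) * sqrt m"
        by (simp add: real_sqrt_mult)
      finally show ?thesis using False by simp
    qed
    then have "cmod (complex_of_real (sqrt (real m * real n))) \<le> graph_spectral_radius ?K"
      using V assms False by (intro K.eigenfunction_le_graph_spectral_radius[of ?f]) auto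
    then show ?thesis by simp
  qed
qed

section \<open>Triangle-free graphs\<close>

lemma (in fin_digraph)
  shows independence_number_attained:
      "\<exists>T. independent_set G T \<and> card T = independence_number G"
    and card_le_independence_number:
      "independent_set G T \<Longrightarrow> card T \<le> independence_number G"
proof -
  let ?C = "{card S |S. independent_set G S}"
  have "?C \<subseteq> card ` Pow (verts G)" by (auto simp: independent_set_def)
  then have fin: "finite ?C" by (rule finite_subset) auto
  \<comment> \<open>Makes the set of cardinalities nonempty, so that its \<open>Max\<close> is
    attained.\<close>
  have "independent_set G {}" by (simp add: independent_set_def)
  then have "Max ?C \<in> ?C" using fin by (intro Max_in) auto
  then show "\<exists>T. independent_set G T \<and> card T = independence_number G"
    unfolding independence_number_def by auto
  show "card T \<le> independence_number G" if "independent_set G T"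
    unfolding independence_number_def using that fin by (intro Max_ge) auto
qed

text \<open>Isolates the one consequence of the block structure on which the counting below
  rests.\<close>

locale triangle_free_graph = graph +
  assumes triangle_free: "u \<rightarrow>\<^bsub>G\<^esub> v \<Longrightarrow> v \<rightarrow>\<^bsub>G\<^esub> w \<Longrightarrow> \<not> u \<rightarrow>\<^bsub>G\<^esub> w"
begin

lemma adj_sym: "u \<rightarrow>\<^bsub>G\<^esub> v \<Longrightarrow> v \<rightarrow>\<^bsub>G\<^esub> u"
  by (rule arcs_ends_symmetric[OF sym_arcs])

lemma independent_neighbourhood: "independent_set G {v. u \<rightarrow>\<^bsub>G\<^esub> v}"
  unfolding independent_set_def by (auto dest: adj_in_verts triangle_free)

lemma degree_le_independence_number: "card {v. u \<rightarrow>\<^bsub>G\<^esub> v} \<le> independence_number G"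
  by (rule card_le_independence_number[OF independent_neighbourhood])

context
  fixes T assumes indep: "independent_set G T"
begin

text \<open>Orient each arc of a walk so that it starts outside the independent set.\<close>

lemma walks_inject_into_cover_arcs:
  fixes u
  defines "walks \<equiv> SIGMA v:{v. u \<rightarrow>\<^bsub>G\<^esub> v}. {w. v \<rightarrow>\<^bsub>G\<^esub> w}"
    and "cov \<equiv> SIGMA s:verts G - T. {x. s \<rightarrow>\<^bsub>G\<^esub> x}"
    and "g \<equiv> \<lambda>(v, w). if v \<in> T then (w, v) else (v, w)"
  shows "inj_on g walks" "g ` walks \<subseteq> cov"
    "g ` walks = cov \<Longrightarrow> independent_set G (verts G - T)"
proof -
  have ind: "\<not> v \<rightarrow>\<^bsub>G\<^esub> w" if "u \<rightarrow>\<^bsub>G\<^esub> v" "u \<rightarrow>\<^bsub>G\<^esub> w" for v w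
    using that triangle_free by blast
  have T: "\<not> v \<rightarrow>\<^bsub>G\<^esub> w" if "v \<in> T" "w \<in> T" for v w
    using that indep by (auto simp: independent_set_def)
  \<comment> \<open>A collision between a swapped and an unswapped walk would make both ends of an
    arc neighbours of \<open>u\<close>, contradicting \<open>ind\<close>.\<close>
  show "inj_on g walks"
    by (auto simp: inj_on_def g_def walks_def split: if_splits dest: ind)
  show "g ` walks \<subseteq> cov"
    by (auto simp: g_def walks_def cov_def split: if_splits dest: T adj_in_verts intro: adj_sym)
  assume eq: "g ` walks = cov"
  have "\<not> s \<rightarrow>\<^bsub>G\<^esub> t" if "s \<in> verts G - T" "t \<in> verts G - T" for s t
  proof
    assume "s \<rightarrow>\<^bsub>G\<^esub> t"
    \<comment> \<open>An edge with both ends outside \<open>T\<close> appears in \<open>cov\<close>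
      in both orientations. A swapped walk ends in \<open>T\<close>, so both preimages are unswapped
      and \<open>u\<close> is adjacent to \<open>s\<close> and to \<open>t\<close>.\<close>
    then have "(s, t) \<in> g ` walks" "(t, s) \<in> g ` walks"
      using that by (auto simp: eq cov_def intro: adj_sym)
    then have "u \<rightarrow>\<^bsub>G\<^esub> s" "u \<rightarrow>\<^bsub>G\<^esub> t"
      using that by (auto simp: g_def walks_def split: if_splits)
    with \<open>s \<rightarrow>\<^bsub>G\<^esub> t\<close> show False using ind by blast
  qed
  then show "independent_set G (verts G - T)" by (auto simp: independent_set_def)
qed

lemma card_cover_arcs_le:
  "card (SIGMA s:verts G - T. {x. s \<rightarrow>\<^bsub>G\<^esub> x}) \<le> card (verts G - T) * independence_number G"
  using sum_bounded_above[of "verts G - T", OF degree_le_independence_number]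
  by (simp add: card_SigmaI finite_successors)

lemma card_walks_le:
  "card (SIGMA v:{v. u \<rightarrow>\<^bsub>G\<^esub> v}. {w. v \<rightarrow>\<^bsub>G\<^esub> w}) \<le> card (verts G - T) * independence_number G"
  using card_inj_on_le[OF walks_inject_into_cover_arcs(1,2)] card_cover_arcs_le finite_successors
  by (meson finite_Diff finite_SigmaI finite_verts order_trans)

lemma arcs_ends_if_card_walks_eq:
  assumes T: "card T = independence_number G"
    and eq: "card (SIGMA v:{v. u \<rightarrow>\<^bsub>G\<^esub> v}. {w. v \<rightarrow>\<^bsub>G\<^esub> w})
      = card (verts G - T) * independence_number G"
  shows "arcs_ends G = T \<times> (verts G - T) \<union> (verts G - T) \<times> T"
proof -
  let ?S = "verts G - T" and ?W = "SIGMA v:{v. u \<rightarrow>\<^bsub>G\<^esub> v}. {w. v \<rightarrow>\<^bsub>G\<^esub> w}"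
    and ?g = "\<lambda>(v, w). if v \<in> T then (w, v) else (v, w)"
  let ?C = "SIGMA s:?S. {x. s \<rightarrow>\<^bsub>G\<^esub> x}"
  have finT: "finite T" using indep finite_verts
    unfolding independent_set_def by (blast intro: finite_subset)
  have finC: "finite ?C" by (simp add: finite_successors)
  \<comment> \<open>The cover arcs are squeezed between the number of walks and the degree bound,
    which coincide by \<open>eq\<close>.\<close>
  have cardC: "card ?C = card ?S * independence_number G"
    using card_inj_on_le[OF walks_inject_into_cover_arcs(1,2) finC, of u] card_cover_arcs_le eq
    by simp
  have "?g ` ?W = ?C"
    using card_image[OF walks_inject_into_cover_arcs(1), of u] eq cardC
    by (intro card_subset_eq[OF finC walks_inject_into_cover_arcs(2)]) simp
  then have S: "independent_set G ?S" by (rule walks_inject_into_cover_arcs(3))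
  have full: "{x. s \<rightarrow>\<^bsub>G\<^esub> x} = T" if s: "s \<in> ?S" for s
  proof (rule card_subset_eq[OF finT])
    show sub: "{x. s \<rightarrow>\<^bsub>G\<^esub> x} \<subseteq> T"
      using S s by (auto simp: independent_set_def dest: adj_in_verts)
    \<comment> \<open>The degree deficits are natural numbers with sum zero, so each vanishes; no
      subtraction truncates because degrees are at most the independence number.\<close>
    have "(\<Sum>s\<in>?S. independence_number G - card {x. s \<rightarrow>\<^bsub>G\<^esub> x}) = 0"
      using cardC degree_le_independence_number
      by (subst sum_subtractf_nat) (auto simp: card_SigmaI finite_successors)
    then have "independence_number G - card {x. s \<rightarrow>\<^bsub>G\<^esub> x} = 0"
      using s by (subst (asm) sum_eq_0_iff) auto
    then show "card {x. s \<rightarrow>\<^bsub>G\<^esub> x} = card T"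
      using degree_le_independence_number[of s] T by simp
  qed
  \<comment> \<open>Arcs starting outside \<open>T\<close> are described by \<open>full\<close>;
    those starting in \<open>T\<close> end outside it and are reversed by symmetry.\<close>
  have "a \<rightarrow>\<^bsub>G\<^esub> b \<longleftrightarrow> (a, b) \<in> T \<times> ?S \<union> ?S \<times> T" for a b
  proof -
    have "a \<rightarrow>\<^bsub>G\<^esub> b \<Longrightarrow> a \<in> T \<Longrightarrow> b \<in> ?S"
      using indep by (auto simp: independent_set_def dest: adj_in_verts)
    moreover have "b \<rightarrow>\<^bsub>G\<^esub> a" if "a \<rightarrow>\<^bsub>G\<^esub> b" using that by (rule adj_sym)
    moreover have "a \<rightarrow>\<^bsub>G\<^esub> b" if "b \<rightarrow>\<^bsub>G\<^esub> a" using that by (rule adj_sym)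
    ultimately show ?thesis using full[of a] full[of b] adj_in_verts[of a b] by blast
  qed
  then show ?thesis by auto
qed

end

end

section \<open>Recognising complete bipartite graphs up to isomorphism\<close>

lemma digraph_iso_complete_bipartite:
  assumes "graph G" and ST: "verts G = S \<union> T" "S \<inter> T = {}" "card S = m" "card T = n"
    and arcs: "arcs_ends G = S \<times> T \<union> T \<times> S"
  shows "digraph_iso G (with_proj (complete_bipartite m n))"
proof -
  interpret graph G by fact
  have fin: "finite S" "finite T" using finite_verts ST(1) by auto
  obtain p where p: "bij_betw p S {..<m}"
    using bij_betw_iff_card[of S "{..<m}"] fin ST by auto
  obtain q where q: "bij_betw q T {m..<m + n}"
    using bij_betw_iff_card[of T "{m..<m + n}"] fin ST by auto
  define h where "h v = (if v \<in> S then p v else q v)" for v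
  have hS: "bij_betw h S {..<m}"
    using p by (simp add: h_def cong: bij_betw_cong)
  have hT: "bij_betw h T {m..<m + n}"
    using q ST(2) by (subst bij_betw_cong[of _ _ q]) (auto simp: h_def)
  have "bij_betw h (S \<union> T) ({..<m} \<union> {m..<m + n})"
    using hS hT by (rule bij_betw_combine) auto
  then have inj: "inj_on h (verts G)" and img: "h ` verts G = {..<m + n}"
    by (auto simp: ST(1) bij_betw_def)
  \<comment> \<open>Arcs of the target are pairs of vertices, so an arc goes to the pair of images
    of its ends. This is injective on arcs because \<open>G\<close> has no parallel arcs.\<close>
  let ?f = "map_prod h h \<circ> arc_to_ends G"
  let ?h = "\<lparr> iso_verts = h, iso_arcs = ?f, iso_head = snd, iso_tail = fst \<rparr>"
  have "inj_on (map_prod h h) (arcs_ends G)"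
    by (rule inj_on_subset[OF map_prod_inj_on[OF inj inj]]) (auto dest: adj_in_verts)
  then have "inj_on ?f (arcs G)"
    unfolding arcs_ends_def by (intro comp_inj_on inj_on_arc_to_ends)
  then have "digraph_isomorphism ?h"
    unfolding digraph_isomorphism_def using inj wf_digraph by (auto simp: arc_to_ends_def)
  moreover have "map_prod h h ` arcs_ends G = {..<m} \<times> {m..<m + n} \<union> {m..<m + n} \<times> {..<m}"
    using hS hT by (simp add: arcs image_Un map_prod_surj_on bij_betw_def)
  then have "with_proj (complete_bipartite m n) = app_iso ?h G"
    by (simp add: app_iso_def with_proj_def complete_bipartite_def img image_comp arcs_ends_def)
  ultimately show ?thesis unfolding digraph_iso_def by blast
qed

section \<open>The bound and its equality case for bi-block graphs\<close>

theorem theorem2p9: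
  fixes G :: "('a, 'b) pre_digraph" and k \<alpha> :: nat
  assumes "k > 0" and "\<alpha> > 0"
    and "bi_block_graph G"
    and "card (verts G) = k"
    and "independence_number G = \<alpha>"
  shows "graph_spectral_radius G
           \<le> graph_spectral_radius (with_proj (complete_bipartite \<alpha> (k - \<alpha>))) \<and>
         (graph_spectral_radius G
            = graph_spectral_radius (with_proj (complete_bipartite \<alpha> (k - \<alpha>)))
          \<longleftrightarrow> digraph_iso G (with_proj (complete_bipartite \<alpha> (k - \<alpha>))))"
proof -
  interpret graph G using assms(3) by (simp add: bi_block_graph_def)
  interpret triangle_free_graph G
    by unfold_locales (use bi_block_graph_triangle_free[OF assms(3)] in blast)
  let ?K = "with_proj (complete_bipartite \<alpha> (k - \<alpha>))"
  let ?\<rho> = "graph_spectral_radius G"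
  have ne: "verts G \<noteq> {}" using assms by auto
  obtain T where T: "independent_set G T" "card T = \<alpha>"
    using independence_number_attained assms(5) by auto
  have TV: "T \<subseteq> verts G" using T(1) by (simp add: independent_set_def)
  \<comment> \<open>The subtraction does not truncate: \<open>T\<close> lies in the vertex set, so
    \<alpha> \<le> \<open>k\<close>.\<close>
  have S: "card (verts G - T) = k - \<alpha>"
    using card_Diff_subset[OF finite_subset[OF TV finite_verts] TV] T assms(4) by simp
  obtain u where u: "?\<rho>\<^sup>2 \<le> card (SIGMA v:{v. u \<rightarrow>\<^bsub>G\<^esub> v}. {w. v \<rightarrow>\<^bsub>G\<^esub> w})"
    using graph_spectral_radius_power2_le_walks[OF ne] by blast
  have walks: "card (SIGMA v:{v. u \<rightarrow>\<^bsub>G\<^esub> v}. {w. v \<rightarrow>\<^bsub>G\<^esub> w}) \<le> (k - \<alpha>) * \<alpha>"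
    using card_walks_le[OF T(1), of u] S assms(5) by simp
  have K: "sqrt (real \<alpha> * real (k - \<alpha>)) \<le> graph_spectral_radius ?K"
    using assms(2) by (rule graph_spectral_radius_complete_bipartite_ge)
  have "?\<rho>\<^sup>2 \<le> real ((k - \<alpha>) * \<alpha>)" using u walks by (meson of_nat_le_iff order_trans)
  then have "?\<rho> \<le> sqrt (real \<alpha> * real (k - \<alpha>))"
    by (intro real_le_rsqrt) (simp add: mult.commute)
  with K have le: "?\<rho> \<le> graph_spectral_radius ?K" by simp
  have "digraph_iso G ?K" if "?\<rho> = graph_spectral_radius ?K"
  proof -
    \<comment> \<open>Equality transfers the lower bound for \<open>?K\<close> to \<open>G\<close>;
      together with \<open>u\<close> and \<open>walks\<close> it forces the walk count to be exactly
      \<open>(k - \<alpha>) * \<alpha>\<close>.\<close>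
    have "real \<alpha> * real (k - \<alpha>) \<le> ?\<rho>\<^sup>2"
      using K that by (metis sqrt_le_D)
    then have "real ((k - \<alpha>) * \<alpha>) \<le> card (SIGMA v:{v. u \<rightarrow>\<^bsub>G\<^esub> v}. {w. v \<rightarrow>\<^bsub>G\<^esub> w})"
      using u by (simp add: mult.commute)
    then have "card (SIGMA v:{v. u \<rightarrow>\<^bsub>G\<^esub> v}. {w. v \<rightarrow>\<^bsub>G\<^esub> w})
        = card (verts G - T) * independence_number G"
      using walks S assms(5) by (simp only: of_nat_le_iff)
    then have "arcs_ends G = T \<times> (verts G - T) \<union> (verts G - T) \<times> T"
      using T assms(5) by (intro arcs_ends_if_card_walks_eq) auto
    then show ?thesis
      using TV T(2) S graph_axioms
      by (intro digraph_iso_complete_bipartite[of G T "verts G - T"])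
        (auto intro: graph.intro digraph_axioms)
  qed
  moreover have "?\<rho> = graph_spectral_radius ?K" if "digraph_iso G ?K"
    using graph_spectral_radius_iso[OF _ that] fin_digraph_axioms by simp
  ultimately show ?thesis using le by blast
qed

end
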